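(* Let $\{\tilde{x}_i\}_{i\ge 0}$ be the sequence of primal iterates, indexed linearly as described in the context, generated by the extended Dykstra's algorithm with arbitrary starting dual vectors $y_1^{(0)},\dots,y_m^{(0)}\in X$ and $y_{m+1}^{(0)}=0$, and with any admissible choice of the sets $C_{m+1}^k$. Then $$\lim_{i\to\infty}\|\tilde{x}_i-P_C(d)\|=0.$$
   Context: Let $X$ be a real Hilbert space, $d\in X$, $m\ge 1$, $C_1,\dots,C_m\subset X$ closed convex sets, and assume $C:=\bigcap_{i=1}^m C_i\neq\emptyset$. For a nonempty closed convex set $D$, $P_D$ denotes the projection onto $D$. Extended Dykstra's algorithm: choose arbitrary $y_1^{(0)},\dots,y_m^{(0)}\in X$, and set $y_{m+1}^{(0)}=0$, $H_{m+1}^0=X$, $x_{m+1}^{(0)}=d-\sum_{i=1}^{m+1}y_i^{(0)}$. For $k=1,2,\dots$: - Set $x_0^{(k)}=x_{m+1}^{(k-1)}$. - For $i=1,\dots,m$ in order: $z_i^{(k)}=x_{i-1}^{(k)}+y_i^{(k-1)}$, $x_i^{(k)}=P_{C_i}(z_i^{(k)})$, $y_i^{(k)}=z_i^{(k)}-x_i^{(k)}$. - Choose any closed convex set $C_{m+1}^k\subset X$ with $C\subset C_{m+1}^k\subset H_{m+1}^{k-1}$ (this is what "admissible" means). - Set $z_{m+1}^{(k)}=x_m^{(k)}+y_{m+1}^{(k-1)}$, $x_{m+1}^{(k)}=P_{C_{m+1}^k}(z_{m+1}^{(k)})$, $y_{m+1}^{(k)}=z_{m+1}^{(k)}-x_{m+1}^{(k)}$.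 - Set $H_{m+1}^k=\{x\in X:\langle y_{m+1}^{(k)},x-x_{m+1}^{(k)}\rangle\le 0\}$. Linear indexing: $\tilde{x}_0=x_{m+1}^{(0)}$ and $\tilde{x}_{(m+1)(k-1)+i}=x_i^{(k)}$ for $k\ge1$, $i\in\{1,\dots,m+1\}$. *)

theory Defs
  imports "HOL-Analysis.Analysis"
begin

(* The library's closest_point requires the Heine-Borel property, hence finite dimension. *)
definition proj :: "'a::{real_inner,complete_space} set \<Rightarrow> 'a \<Rightarrow> 'a"
  where "proj D u = (THE p. p \<in> D \<and> (\<forall>q\<in>D. dist u p \<le> dist u q))"

(* A run of the algorithm, as a relation, since the sets E k (written C_{m+1}^k in the
   literature) may be chosen adaptively.  In x k i, y k i, z k i the first argument is the
   cycle and the second the set index.  The starting vectors y 0 1, ..., y 0 m are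
   unconstrained; E 0 plays no role. *)
definition extended_dykstra ::
  "nat \<Rightarrow> 'a::{real_inner,complete_space} \<Rightarrow> (nat \<Rightarrow> 'a set) \<Rightarrow> (nat \<Rightarrow> 'a set) \<Rightarrow> (nat \<Rightarrow> 'a set) \<Rightarrow>
   (nat \<Rightarrow> nat \<Rightarrow> 'a) \<Rightarrow> (nat \<Rightarrow> nat \<Rightarrow> 'a) \<Rightarrow> (nat \<Rightarrow> nat \<Rightarrow> 'a) \<Rightarrow> bool"
  where "extended_dykstra m d C E H x y z \<longleftrightarrow>
    y 0 (m + 1) = 0 \<and>
    H 0 = UNIV \<and>
    x 0 (m + 1) = d - (\<Sum>i=1..m + 1. y 0 i) \<and>
    (\<forall>k\<ge>1.
      x k 0 = x (k - 1) (m + 1) \<and>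
      (\<forall>i\<in>{1..m}.
        z k i = x k (i - 1) + y (k - 1) i \<and>
        x k i = proj (C i) (z k i) \<and>
        y k i = z k i - x k i) \<and>
      closed (E k) \<and> convex (E k) \<and> (\<Inter>i\<in>{1..m}. C i) \<subseteq> E k \<and> E k \<subseteq> H (k - 1) \<and>
      z k (m + 1) = x k m + y (k - 1) (m + 1) \<and>
      x k (m + 1) = proj (E k) (z k (m + 1)) \<and>
      y k (m + 1) = z k (m + 1) - x k (m + 1) \<and>
      H k = {u. y k (m + 1) \<bullet> (u - x k (m + 1)) \<le> 0})"

definition linear_iterates :: "nat \<Rightarrow> (nat \<Rightarrow> nat \<Rightarrow> 'a) \<Rightarrow> nat \<Rightarrow> 'a"
  where "linear_iterates m x n =
    (if n = 0 then x 0 (m + 1)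
     else x ((n - 1) div (m + 1) + 1) ((n - 1) mod (m + 1) + 1))"

lemma linear_iterates_0: "linear_iterates m x 0 = x 0 (m + 1)"
  by (simp add: linear_iterates_def)

lemma linear_iterates_index:
  assumes "k \<ge> 1" and "i \<in> {1..m + 1}"
  shows "linear_iterates m x ((m + 1) * (k - 1) + i) = x k i"
proof -
  obtain j where j: "i = Suc j" "j < m + 1"
    using assms(2) by (cases i) auto
  have "((m + 1) * (k - 1) + j) div (m + 1) = k - 1"
    by (subst div_mult_self4) (use j in simp_all)
  moreover have "((m + 1) * (k - 1) + j) mod (m + 1) = j"
    by (subst mod_mult_self4) (use j in simp_all)
  ultimately show ?thesis
    using assms(1) j(1) by (simp add: linear_iterates_def)
qed

end

theory Submission
  imports Defs
begin

text \<open>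
  Write $M = m + 1$ and let $c$ be a point of the intersection $C$. From the end of the first
  cycle on, each dual vector $y_i$ is an outer normal at $x_i$ of the set last projected onto.
  Hence the potential $\|x_M - c\|^2 + 2 \sum_i \langle y_i, x_i - c \rangle$ has nonnegative
  terms, and one cycle lowers it by at least the sum of the squared steps
  (\<open>potential_decrease\<close>). The condition $C_{m+1}^k \subseteq H_{m+1}^{k-1}$ is what
  lets the varying last set take part in this estimate: the new iterate lies in the old half-space,
  just as for a fixed set the new iterate lies in the set that the old normal supports.

  The algorithm preserves $x_M + \sum_i y_i = d$ at the ends of cycles (\<open>primal_dual\<close>).
  Therefore $\langle d - x_M, x_M - c \rangle$ equals the nonnegative dual sum
  $\sum_i \langle y_i, x_i - c \rangle$ up to the error $\sum_i \langle y_i, x_M - x_i \rangle$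
  (\<open>dual_sum_eq\<close>). The dual vectors need not stay bounded, but they grow no faster than
  the accumulated step lengths, so with $a_k$ the path length of a cycle and $B$ the initial size of the dual vectors the error
  is at most $a_k (B + \sum_{l \le k} a_l)$. Since $\sum_k a_k^2$ converges, this bound becomes arbitrarily small
  along a subsequence of cycles (\<open>square_summable_times_partial_sums\<close>).

  Along that subsequence the points $x_M$ approach every $C_i$ and are asymptotically no farther
  from $d$ than $P_C(d)$ is. Such a sequence converges in norm to $P_C(d)$
  (\<open>asymptotically_optimal_tendsto_nearest_point\<close>); the parallelogram law, applied to
  minimizing sequences in nested convex sets, does the work of weak compactness here. With
  $c = P_C(d)$ the potential then tends to $0$ along the subsequence, hence along all cycles
  because it is monotone, and it dominates $\|x_M - P_C(d)\|^2$.
\<close>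

section \<open>Minimizing sequences and projections in a Hilbert space\<close>

text \<open>
  For late indices $i, j \ge N$ the midpoint of $w_i$ and $w_j$ still lies in $D_N$, so its distance
  to $u$ is at least $r_N$, and the parallelogram law makes $w$ a Cauchy sequence. A constant
  sequence of sets gives the existence of projections; decreasing sets handle iterates that
  are feasible only in the limit.
\<close>
lemma nested_minimizing_sequence_converges:
  fixes D :: "nat \<Rightarrow> 'a::{real_inner,complete_space} set"
  assumes cl: "\<And>n. closed (D n)" and cv: "\<And>n. convex (D n)" and dec: "decseq D"
    and w: "\<And>n. w n \<in> D n"
    and r: "\<And>n q. q \<in> D n \<Longrightarrow> r n \<le> dist u q" and r0: "\<And>n. 0 \<le> r n"
    and rL: "r \<longlonglongrightarrow> L" and wL: "(\<lambda>n. dist u (w n)) \<longlonglongrightarrow> L"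
  obtains p where "w \<longlonglongrightarrow> p" "\<And>n. p \<in> D n"
proof -
  have wD: "w i \<in> D n" if "n \<le> i" for i n
    using w[of i] decseqD[OF dec that] by blast
  have "Cauchy w"
  proof (rule metric_CauchyI)
    fix e :: real assume "0 < e"
    have "\<forall>\<^sub>F n in sequentially. L\<^sup>2 - e\<^sup>2 / 8 < (r n)\<^sup>2"
      using tendsto_power[OF rL, of 2] \<open>0 < e\<close> by (intro order_tendstoD(1)[of _ "L\<^sup>2"]) auto
    moreover have "\<forall>\<^sub>F n in sequentially. (dist u (w n))\<^sup>2 < L\<^sup>2 + e\<^sup>2 / 8"
      using tendsto_power[OF wL, of 2] \<open>0 < e\<close> by (intro order_tendstoD(2)[of _ "L\<^sup>2"]) auto
    ultimately obtain N where N: "\<And>n. N \<le> n \<Longrightarrow> L\<^sup>2 - e\<^sup>2 / 8 < (r n)\<^sup>2"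
      "\<And>n. N \<le> n \<Longrightarrow> (dist u (w n))\<^sup>2 < L\<^sup>2 + e\<^sup>2 / 8"
      by (metis (no_types, lifting) eventually_conj eventually_sequentially)
    have "dist (w i) (w j) < e" if ij: "N \<le> i" "N \<le> j" for i j
    proof -
      have "(1/2) *\<^sub>R w i + (1/2) *\<^sub>R w j \<in> D N"
        using convexD[OF cv wD[OF ij(1)] wD[OF ij(2)], of "1/2" "1/2"] by simp
      then have "r N \<le> norm (u - ((1/2) *\<^sub>R w i + (1/2) *\<^sub>R w j))"
        using r by (metis dist_norm)
      then have mid: "(r N)\<^sup>2 \<le> (norm (u - ((1/2) *\<^sub>R w i + (1/2) *\<^sub>R w j)))\<^sup>2"
        using r0 by (intro power_mono) auto
      have "(dist (w i) (w j))\<^sup>2 = 2 * (dist u (w i))\<^sup>2 + 2 * (dist u (w j))\<^sup>2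
          - 4 * (norm (u - ((1/2) *\<^sub>R w i + (1/2) *\<^sub>R w j)))\<^sup>2"
        by (simp add: dist_norm power2_norm_eq_inner inner_diff_left inner_diff_right
            inner_add_left inner_add_right inner_commute algebra_simps)
      also have "\<dots> < e\<^sup>2"
        using mid N(1)[of N] N(2)[OF ij(1)] N(2)[OF ij(2)] by simp
      finally show ?thesis
        using \<open>0 < e\<close> by (simp add: power_less_imp_less_base)
    qed
    then show "\<exists>M. \<forall>m\<ge>M. \<forall>n\<ge>M. dist (w m) (w n) < e" by blast
  qed
  then obtain p where p: "w \<longlonglongrightarrow> p"
    using Cauchy_convergent convergentD by blast
  moreover have "p \<in> D n" for n
    using wD by (intro Lim_in_closed_set[OF cl _ _ p])
      (auto simp: eventually_sequentially)
  ultimately show ?thesis by (rule that)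
qed

lemma infdist_approx:
  assumes "A \<noteq> {}" "0 < e"
  shows "\<exists>a\<in>A. dist x a < infdist x A + e"
proof -
  have "(INF a\<in>A. dist x a) < infdist x A + e"
    using assms by (simp add: infdist_notempty)
  then show ?thesis
    using assms(1) by (subst (asm) cINF_less_iff) auto
qed

lemma nearest_point_exists:
  fixes D :: "'a::{real_inner,complete_space} set"
  assumes "closed D" "convex D" "D \<noteq> {}"
  obtains p where "p \<in> D" "\<And>q. q \<in> D \<Longrightarrow> dist u p \<le> dist u q"
proof -
  have "\<exists>a\<in>D. dist u a < infdist u D + inverse (Suc n)" for n
    using assms(3) by (intro infdist_approx) auto
  then obtain w where w: "\<And>n. w n \<in> D" "\<And>n. dist u (w n) < infdist u D + inverse (Suc n)"
    by metis
  have "(\<lambda>n. infdist u D + inverse (Suc n)) \<longlonglongrightarrow> infdist u D + 0"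
    by (intro tendsto_intros LIMSEQ_inverse_real_of_nat)
  then have lim: "(\<lambda>n. dist u (w n)) \<longlonglongrightarrow> infdist u D"
    using tendsto_sandwich[of "\<lambda>_. infdist u D" "\<lambda>n. dist u (w n)" sequentially
        "\<lambda>n. infdist u D + inverse (Suc n)" "infdist u D"] w
    by (simp add: infdist_le less_imp_le always_eventually)
  obtain p where p: "w \<longlonglongrightarrow> p" "p \<in> D"
    by (rule nested_minimizing_sequence_converges[of "\<lambda>_. D" w "\<lambda>_. infdist u D" u "infdist u D"])
      (use assms w lim in \<open>auto simp: infdist_le infdist_nonneg decseq_def\<close>)
  have "dist u p = infdist u D"
    using tendsto_dist[OF tendsto_const p(1)] lim LIMSEQ_unique by blast
  then show ?thesis
    using p(2) that infdist_le by metis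
qed

lemma proj_nearest:
  fixes D :: "'a::{real_inner,complete_space} set"
  assumes "closed D" "convex D" "D \<noteq> {}"
  shows proj_in: "proj D u \<in> D"
    and proj_le: "\<And>q. q \<in> D \<Longrightarrow> dist u (proj D u) \<le> dist u q"
proof -
  have "\<exists>!p. p \<in> D \<and> (\<forall>q\<in>D. dist u p \<le> dist u q)"
    using nearest_point_exists[OF assms] any_closest_point_unique[OF assms(2,1)] by metis
  from theI'[OF this] show "proj D u \<in> D" "\<And>q. q \<in> D \<Longrightarrow> dist u (proj D u) \<le> dist u q"
    unfolding proj_def by auto
qed

lemma convex_infdist_le:
  fixes S :: "'a::real_normed_vector set"
  assumes "convex S" "S \<noteq> {}"
  shows "convex {x. infdist x S \<le> e}"
proof (rule convexI, clarsimp)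
  fix x y :: 'a and s t :: real
  assume xy: "infdist x S \<le> e" "infdist y S \<le> e" and st: "0 \<le> s" "0 \<le> t" "s + t = 1"
  show "infdist (s *\<^sub>R x + t *\<^sub>R y) S \<le> e"
  proof (rule field_le_epsilon)
    fix h :: real assume "0 < h"
    obtain a b where ab: "a \<in> S" "dist x a < infdist x S + h" "b \<in> S" "dist y b < infdist y S + h"
      using infdist_approx[OF assms(2) \<open>0 < h\<close>] by blast
    have "infdist (s *\<^sub>R x + t *\<^sub>R y) S \<le> dist (s *\<^sub>R x + t *\<^sub>R y) (s *\<^sub>R a + t *\<^sub>R b)"
      using convexD[OF assms(1) ab(1,3) st] by (rule infdist_le)
    also have "\<dots> = norm (s *\<^sub>R (x - a) + t *\<^sub>R (y - b))"
      by (simp add: dist_norm algebra_simps)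
    also have "\<dots> \<le> s * norm (x - a) + t * norm (y - b)"
      using norm_triangle_ineq[of "s *\<^sub>R (x - a)" "t *\<^sub>R (y - b)"] st by simp
    also have "\<dots> \<le> s * (e + h) + t * (e + h)"
      using ab xy st by (intro add_mono mult_left_mono) (auto simp: dist_norm)
    also have "\<dots> = e + h"
      using st(3) by (metis distrib_right mult_1)
    finally show "infdist (s *\<^sub>R x + t *\<^sub>R y) S \<le> e + h" .
  qed
qed

text \<open>
  Let $D_n$ be the closed convex hull of $p$ and the tail of $w$ from $n$ on. Closed neighbourhoods
  of the $C_i$ are convex, so they contain $D_n$ for large $n$ and $\bigcap_n D_n$ lies in the
  intersection of the $C_i$. Near-minimizers of the distance to $u$ over $D_n$ converge to a point of
  that intersection, which pushes the distance from $u$ to $D_n$ up to the distance from $u$ to $p$.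
  The sequence $w$ is then itself minimizing for the sets $D_n$.
\<close>
lemma asymptotically_optimal_tendsto_nearest_point:
  fixes C :: "'i \<Rightarrow> 'a::{real_inner,complete_space} set"
  assumes cl: "\<And>i. i \<in> I \<Longrightarrow> closed (C i)" and cv: "\<And>i. i \<in> I \<Longrightarrow> convex (C i)"
    and p: "p \<in> (\<Inter>i\<in>I. C i)" and pmin: "\<And>q. q \<in> (\<Inter>i\<in>I. C i) \<Longrightarrow> dist u p \<le> dist u q"
    and feas: "\<And>i. i \<in> I \<Longrightarrow> (\<lambda>n. infdist (w n) (C i)) \<longlonglongrightarrow> 0"
    and opt: "\<And>n. dist u (w n) \<le> g n" and g: "g \<longlonglongrightarrow> dist u p"
  shows "w \<longlonglongrightarrow> p"
proof -
  define D where "D n = closure (convex hull (insert p (w ` {n..})))" for n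
  define r where "r n = infdist u (D n)" for n
  have clD: "closed (D n)" and cvD: "convex (D n)" for n
    unfolding D_def by (auto intro: convex_convex_hull)
  have decD: "decseq D"
    unfolding D_def decseq_def by (intro allI impI closure_mono hull_mono) auto
  have sub: "insert p (w ` {n..}) \<subseteq> D n" for n
    unfolding D_def using closure_subset hull_subset by (rule subset_trans[rotated])
  then have pD: "p \<in> D n" and wD: "w n \<in> D n" for n
    by auto
  have in_all: "q \<in> (\<Inter>i\<in>I. C i)" if q: "\<And>n. q \<in> D n" for q
  proof
    fix i assume i: "i \<in> I"
    have ne: "C i \<noteq> {}" using p i by auto
    have "infdist q (C i) \<le> 0 + e" if "0 < e" for e
    proof -
      obtain n where n: "\<And>k. n \<le> k \<Longrightarrow> infdist (w k) (C i) < e"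
        using order_tendstoD(2)[OF feas[OF i] \<open>0 < e\<close>] by (auto simp: eventually_sequentially)
      have "closed {x. infdist x (C i) \<le> e}"
        by (intro closed_Collect_le continuous_intros)
      moreover have "insert p (w ` {n..}) \<subseteq> {x. infdist x (C i) \<le> e}"
        using n p i \<open>0 < e\<close> by (auto intro: less_imp_le)
      ultimately have "D n \<subseteq> {x. infdist x (C i) \<le> e}"
        unfolding D_def using convex_infdist_le[OF cv[OF i] ne]
        by (intro closure_minimal hull_minimal)
      then show ?thesis using q[of n] by auto
    qed
    then have "infdist q (C i) \<le> 0" by (rule field_le_epsilon)
    then show "q \<in> C i"
      using in_closed_iff_infdist_zero[OF cl[OF i] ne] infdist_nonneg[of q "C i"] by auto
  qed
  have rle: "r n \<le> dist u q" if "q \<in> D n" for n q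
    unfolding r_def using that by (rule infdist_le)
  have r0: "0 \<le> r n" for n
    by (simp add: r_def infdist_nonneg)
  have "incseq r"
    unfolding r_def incseq_def using decseqD[OF decD] pD by (blast intro: infdist_mono)
  then obtain L where L: "r \<longlonglongrightarrow> L"
    using incseq_convergent[of r "dist u p"] rle[OF pD] by metis
  have "\<exists>a\<in>D n. dist u a < r n + inverse (Suc n)" for n
    using pD unfolding r_def by (intro infdist_approx) auto
  then obtain v where v: "\<And>n. v n \<in> D n" "\<And>n. dist u (v n) < r n + inverse (Suc n)"
    by metis
  have "(\<lambda>n. r n + inverse (Suc n)) \<longlonglongrightarrow> L + 0"
    by (intro tendsto_intros L LIMSEQ_inverse_real_of_nat)
  then have vL: "(\<lambda>n. dist u (v n)) \<longlonglongrightarrow> L"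
    using tendsto_sandwich[of r "\<lambda>n. dist u (v n)" sequentially
        "\<lambda>n. r n + inverse (Suc n)" L] v rle L
    by (simp add: less_imp_le always_eventually)
  obtain q where q: "v \<longlonglongrightarrow> q" "\<And>n. q \<in> D n"
    using nested_minimizing_sequence_converges[OF clD cvD decD v(1) rle r0 L vL] by blast
  have "L = dist u q"
    using tendsto_dist[OF tendsto_const q(1)] vL LIMSEQ_unique by blast
  moreover have "L \<le> dist u p"
    using LIMSEQ_le_const2[OF L] rle pD by blast
  ultimately have "L = dist u p"
    using pmin[OF in_all[OF q(2)]] by simp
  then have wL: "(\<lambda>n. dist u (w n)) \<longlonglongrightarrow> L"
    using tendsto_sandwich[of r "\<lambda>n. dist u (w n)" sequentially g L] rle wD opt g L
    by (simp add: always_eventually)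
  obtain p' where p': "w \<longlonglongrightarrow> p'" "\<And>n. p' \<in> D n"
    using nested_minimizing_sequence_converges[OF clD cvD decD wD rle r0 L wL] by blast
  have "dist u p' = dist u p"
    using tendsto_dist[OF tendsto_const p'(1)] wL LIMSEQ_unique \<open>L = dist u p\<close> by blast
  moreover have "closed (\<Inter>i\<in>I. C i)" "convex (\<Inter>i\<in>I. C i)"
    using cl cv by (auto intro: closed_INT convex_INT)
  ultimately have "p' = p"
    using any_closest_point_unique[of "\<Inter>i\<in>I. C i" p' p u] in_all[OF p'(2)] p pmin by simp
  with p'(1) show ?thesis by simp
qed

section \<open>Small increments along a square-summable sequence\<close>

text \<open>
  By the Cauchy-Schwarz inequality the partial sums of $a$ are $O(\sqrt k)$. If the products stayed
  above $e$, then $a_k^2$ would dominate a multiple of $1/k$.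
\<close>
lemma square_summable_times_partial_sums:
  fixes a :: "nat \<Rightarrow> real"
  assumes sm: "summable (\<lambda>k. (a k)\<^sup>2)" and nn: "\<And>k. 0 \<le> a k" and B: "0 \<le> B" and e: "0 < e"
  shows "\<exists>k\<ge>N. a k * (B + (\<Sum>l\<le>k. a l)) < e"
proof (rule ccontr)
  assume "\<not> ?thesis"
  then have ge: "e \<le> a k * (B + (\<Sum>l\<le>k. a l))" if "N \<le> k" for k
    using that by (auto simp: not_less)
  define K where "K = 2 * B\<^sup>2 + 2 * (\<Sum>k. (a k)\<^sup>2) + 1"
  have Kpos: "0 < K"
    unfolding K_def by (intro add_nonneg_pos add_nonneg_nonneg mult_nonneg_nonneg suminf_nonneg sm) auto
  have growth: "(B + (\<Sum>l\<le>k. a l))\<^sup>2 \<le> K * real (Suc k)" for k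
  proof -
    have "(\<Sum>l\<le>k. a l)\<^sup>2 \<le> (\<Sum>l\<le>k. (a l)\<^sup>2) * card {..k}"
      by (rule sum_squared_le_sum_of_squares)
    also have "\<dots> \<le> (\<Sum>l. (a l)\<^sup>2) * real (Suc k)"
      using sum_le_suminf[OF sm, of "{..k}"] by (intro mult_mono) (auto intro: suminf_nonneg sm)
    finally have 1: "(\<Sum>l\<le>k. a l)\<^sup>2 \<le> (\<Sum>l. (a l)\<^sup>2) * real (Suc k)" .
    have "(B + (\<Sum>l\<le>k. a l))\<^sup>2 \<le> 2 * B\<^sup>2 + 2 * (\<Sum>l\<le>k. a l)\<^sup>2"
      using zero_le_power2[of "B - (\<Sum>l\<le>k. a l)"] by (simp add: power2_eq_square algebra_simps)
    also have "\<dots> \<le> 2 * B\<^sup>2 * real (Suc k) + 2 * ((\<Sum>l. (a l)\<^sup>2) * real (Suc k))"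
      using 1 mult_left_mono[of 1 "real (Suc k)" "2 * B\<^sup>2"] by (intro add_mono) auto
    also have "\<dots> \<le> K * real (Suc k)"
      unfolding K_def by (simp add: algebra_simps)
    finally show ?thesis .
  qed
  have bound: "(e\<^sup>2 / K) * inverse (real (Suc k)) \<le> (a k)\<^sup>2" if "N \<le> k" for k
  proof -
    have "e\<^sup>2 \<le> (a k * (B + (\<Sum>l\<le>k. a l)))\<^sup>2"
      using ge[OF that] e by (intro power_mono) auto
    also have "\<dots> \<le> (a k)\<^sup>2 * (K * real (Suc k))"
      unfolding power_mult_distrib using growth by (intro mult_left_mono) auto
    finally have "e\<^sup>2 / (K * real (Suc k)) \<le> (a k)\<^sup>2"
      using Kpos by (subst pos_divide_le_eq) auto
    then show ?thesis
      by (simp add: divide_simps)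
  qed
  have "summable (\<lambda>k. (e\<^sup>2 / K) * inverse (real (Suc k)))"
  proof (rule summable_comparison_test[OF _ sm], intro exI[of _ N] allI impI)
    fix k assume "N \<le> k"
    moreover have "0 \<le> (e\<^sup>2 / K) * inverse (real (Suc k))" using Kpos by simp
    ultimately show "norm ((e\<^sup>2 / K) * inverse (real (Suc k))) \<le> (a k)\<^sup>2"
      using bound by (metis real_norm_def abs_of_nonneg)
  qed
  then have "summable (\<lambda>k. inverse (real (Suc k)))"
    using e Kpos by (subst (asm) summable_cmult_iff) auto
  then show False
    using not_summable_harmonic[where 'a=real] summable_Suc_iff[of "\<lambda>k. inverse (real k)"] by simp
qed


section \<open>Dykstra cycles\<close>

text \<open>
  An update moves to $a_i$ exactly what $t_i$ loses against $s_i$; summing over a cycle shows that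
  the sum of the primal vector and all dual vectors is conserved.
\<close>
lemma sum_of_cycle_updates:
  fixes a s t :: "nat \<Rightarrow> 'a::ab_group_add"
  assumes "\<And>i. i \<in> {1..M} \<Longrightarrow> a i = a (i - 1) + s i - t i"
  shows "a M + (\<Sum>i=1..M. t i) = a 0 + (\<Sum>i=1..M. s i)"
proof -
  have "a M - a 0 = (\<Sum>i=1..M. a i - a (i - 1))"
    using sum_telescope''[of 0 M a] by simp
  also have "\<dots> = (\<Sum>i=1..M. s i - t i)"
    using assms by (intro sum.cong) auto
  finally show ?thesis
    by (simp add: sum_subtractf algebra_simps)
qed

text \<open>
  The locale keeps only those properties of a run that hold from the end of the first cycle on, with
  cycles counted from there: arbitrary starting vectors need not be normals, so the two
  separation inequalities can fail for them. The indices in \<open>J\<close> belong to fixed sets. The others, whose sets may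
  change from cycle to cycle, enter only through \<open>separates\<close> and \<open>separates_next\<close>: the half-space
  that \<open>y k i\<close> cuts off at \<open>x k i\<close> contains the feasible set and the next iterate.
\<close>
locale dykstra_cycles =
  fixes M :: nat and J :: "nat set" and d :: "'a::{real_inner,complete_space}"
    and C :: "nat \<Rightarrow> 'a set" and x y :: "nat \<Rightarrow> nat \<Rightarrow> 'a"
  assumes J: "J \<subseteq> {1..M}"
    and closed_C: "i \<in> J \<Longrightarrow> closed (C i)"
    and convex_C: "i \<in> J \<Longrightarrow> convex (C i)"
    and start: "x 0 M = d - (\<Sum>i=1..M. y 0 i)"
    and next_cycle: "x (Suc k) 0 = x k M"
    and update: "i \<in> {1..M} \<Longrightarrow> x (Suc k) i = x (Suc k) (i - 1) + y k i - y (Suc k) i"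
    and x_in_C: "i \<in> J \<Longrightarrow> x k i \<in> C i"
    and separates: "i \<in> {1..M} \<Longrightarrow> c \<in> (\<Inter>i\<in>J. C i) \<Longrightarrow> y k i \<bullet> (c - x k i) \<le> 0"
    and separates_next: "i \<in> {1..M} \<Longrightarrow> y k i \<bullet> (x (Suc k) i - x k i) \<le> 0"
begin

text \<open>
  By \<open>update\<close>, each summand is the length of the step from \<open>x (Suc k) (i - 1)\<close> to
  \<open>x (Suc k) i\<close>, so this is the length of the path run through in cycle \<open>Suc k\<close>.
\<close>
definition travel :: "nat \<Rightarrow> real"
  where "travel k = (\<Sum>i=1..M. norm (y (Suc k) i - y k i))"

definition potential :: "'a \<Rightarrow> nat \<Rightarrow> real"
  where "potential c k = (norm (x k M - c))\<^sup>2 + 2 * (\<Sum>i=1..M. y k i \<bullet> (x k i - c))"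

definition defect :: "nat \<Rightarrow> real"
  where "defect k = travel k * ((\<Sum>i=1..M. norm (y 0 i)) + (\<Sum>l\<le>k. travel l))"

lemma travel_nonneg: "0 \<le> travel k"
  by (simp add: travel_def sum_nonneg)

lemma defect_nonneg: "0 \<le> defect k"
  unfolding defect_def by (intro mult_nonneg_nonneg add_nonneg_nonneg sum_nonneg travel_nonneg) auto

lemma primal_step:
  assumes "i \<in> {1..M}"
  shows "x (Suc k) (i - 1) = x (Suc k) i + (y (Suc k) i - y k i)"
  using update[OF assms, of k] by simp

lemma primal_dual: "x k M = d - (\<Sum>i=1..M. y k i)"
proof (induction k)
  case 0
  show ?case by (rule start)
next
  case (Suc k)
  have "x (Suc k) M + (\<Sum>i=1..M. y (Suc k) i) = x (Suc k) 0 + (\<Sum>i=1..M. y k i)"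
    by (rule sum_of_cycle_updates) (rule update)
  then show ?case
    by (simp add: next_cycle Suc.IH algebra_simps)
qed

lemma distance_to_cycle_end:
  assumes "i \<le> M"
  shows "norm (x (Suc k) M - x (Suc k) i) \<le> travel k"
proof -
  have "x (Suc k) M - x (Suc k) i = (\<Sum>j=Suc i..M. x (Suc k) j - x (Suc k) (j - 1))"
    using sum_telescope''[OF assms, of "x (Suc k)"] by simp
  then have "norm (x (Suc k) M - x (Suc k) i) \<le> (\<Sum>j=Suc i..M. norm (x (Suc k) j - x (Suc k) (j - 1)))"
    by (simp add: norm_sum)
  also have "\<dots> = (\<Sum>j=Suc i..M. norm (y (Suc k) j - y k j))"
    using primal_step by (intro sum.cong) (auto simp: norm_minus_commute)
  also have "\<dots> \<le> travel k"
    unfolding travel_def by (intro sum_mono2) auto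
  finally show ?thesis .
qed

text \<open>
  The dual vectors may be unbounded, but each changes exactly by a primal step, so the total
  travel controls their growth.
\<close>
lemma sum_norm_dual_le: "(\<Sum>i=1..M. norm (y k i)) \<le> (\<Sum>i=1..M. norm (y 0 i)) + (\<Sum>l<k. travel l)"
proof (induction k)
  case (Suc k)
  have "(\<Sum>i=1..M. norm (y (Suc k) i)) \<le> (\<Sum>i=1..M. norm (y k i) + norm (y (Suc k) i - y k i))"
    by (intro sum_mono norm_triangle_sub)
  with Suc.IH show ?case
    by (simp add: travel_def sum.distrib)
qed simp

lemma dual_pairing_le_defect:
  "\<bar>\<Sum>i=1..M. y (Suc k) i \<bullet> (x (Suc k) M - x (Suc k) i)\<bar> \<le> defect k"
proof -
  have "\<bar>\<Sum>i=1..M. y (Suc k) i \<bullet> (x (Suc k) M - x (Suc k) i)\<bar>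
      \<le> (\<Sum>i=1..M. norm (y (Suc k) i) * norm (x (Suc k) M - x (Suc k) i))"
    by (intro sum_abs[THEN order_trans] sum_mono Cauchy_Schwarz_ineq2)
  also have "\<dots> \<le> (\<Sum>i=1..M. norm (y (Suc k) i) * travel k)"
    by (intro sum_mono mult_left_mono distance_to_cycle_end) auto
  also have "\<dots> = travel k * (\<Sum>i=1..M. norm (y (Suc k) i))"
    by (simp add: sum_distrib_left mult.commute)
  also have "\<dots> \<le> defect k"
    unfolding defect_def using sum_norm_dual_le[of "Suc k"]
    by (intro mult_left_mono travel_nonneg) (simp add: lessThan_Suc_atMost)
  finally show ?thesis .
qed

lemma dual_sum_nonneg:
  assumes "c \<in> (\<Inter>i\<in>J. C i)"
  shows "0 \<le> (\<Sum>i=1..M. y k i \<bullet> (x k i - c))"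
proof (rule sum_nonneg)
  fix i assume "i \<in> {1..M}"
  from separates[OF this assms, of k] show "0 \<le> y k i \<bullet> (x k i - c)"
    by (simp add: inner_diff_right)
qed

lemma potential_ge:
  assumes "c \<in> (\<Inter>i\<in>J. C i)"
  shows "(norm (x k M - c))\<^sup>2 \<le> potential c k"
  using dual_sum_nonneg[OF assms, of k] by (simp add: potential_def)

text \<open>
  A step has the form $x_{i-1} = x_i + \delta_i$ with $\delta_i = y_i - y_i'$, where primes mark the
  previous cycle. Expanding the square gives
  \[ \|x_{i-1} - c\|^2 = \|x_i - c\|^2 + \|\delta_i\|^2 + 2 \langle y_i, x_i - c \rangle
      - 2 \langle y_i', x_i - c \rangle , \]
  and $\langle y_i', x_i - c \rangle \le \langle y_i', x_i' - c \rangle$ by \<open>separates_next\<close>.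
\<close>
lemma potential_decrease:
  "potential c (Suc k) + (\<Sum>i=1..M. (norm (y (Suc k) i - y k i))\<^sup>2) \<le> potential c k"
proof -
  let ?u = "\<lambda>i. x (Suc k) i" and ?\<delta> = "\<lambda>i. y (Suc k) i - y k i"
  have step: "(norm (?u i - c))\<^sup>2 - (norm (?u (i - 1) - c))\<^sup>2 + (norm (?\<delta> i))\<^sup>2
      + 2 * (y (Suc k) i \<bullet> (?u i - c)) \<le> 2 * (y k i \<bullet> (x k i - c))" if i: "i \<in> {1..M}" for i
  proof -
    have "(norm (?u (i - 1) - c))\<^sup>2 = (norm ((?u i - c) + ?\<delta> i))\<^sup>2"
      by (simp only: primal_step[OF i]) (simp add: algebra_simps)
    also have "\<dots> = (norm (?u i - c))\<^sup>2 + (norm (?\<delta> i))\<^sup>2 + 2 * (?\<delta> i \<bullet> (?u i - c))"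
      by (simp add: power2_norm_eq_inner inner_add_left inner_add_right inner_commute)
    finally show ?thesis
      using separates_next[OF i, of k] by (simp add: inner_diff_left inner_diff_right)
  qed
  have "(\<Sum>i=1..M. (norm (?u i - c))\<^sup>2 - (norm (?u (i - 1) - c))\<^sup>2 + (norm (?\<delta> i))\<^sup>2
      + 2 * (y (Suc k) i \<bullet> (?u i - c))) \<le> (\<Sum>i=1..M. 2 * (y k i \<bullet> (x k i - c)))"
    using step by (rule sum_mono)
  moreover have "(\<Sum>i=1..M. (norm (?u i - c))\<^sup>2 - (norm (?u (i - 1) - c))\<^sup>2)
      = (norm (?u M - c))\<^sup>2 - (norm (x k M - c))\<^sup>2"
    using sum_telescope''[of 0 M "\<lambda>i. (norm (?u i - c))\<^sup>2"] by (simp add: next_cycle)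
  ultimately show ?thesis
    unfolding potential_def by (simp add: sum.distrib sum_distrib_left)
qed

lemma decseq_potential: "decseq (potential c)"
proof (rule decseq_SucI)
  fix k
  have "0 \<le> (\<Sum>i=1..M. (norm (y (Suc k) i - y k i))\<^sup>2)"
    by (intro sum_nonneg) auto
  with potential_decrease[of c k] show "potential c (Suc k) \<le> potential c k"
    by linarith
qed

lemma summable_travel_squared:
  assumes "c \<in> (\<Inter>i\<in>J. C i)"
  shows "summable (\<lambda>k. (travel k)\<^sup>2)"
proof -
  have "0 \<le> potential c k" for k
    using potential_ge[OF assms, of k] by (rule order_trans[rotated]) simp
  then obtain L where "potential c \<longlonglongrightarrow> L"
    using decseq_convergent[OF decseq_potential, of 0 c] by metis
  then have "summable (\<lambda>k. real M * (potential c k - potential c (Suc k)))"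
    by (intro summable_mult telescope_summable')
  then show ?thesis
  proof (rule summable_comparison_test[rotated], intro exI[of _ 0] allI impI)
    fix k
    have "(travel k)\<^sup>2 \<le> (\<Sum>i=1..M. (norm (y (Suc k) i - y k i))\<^sup>2) * card {1..M}"
      unfolding travel_def by (rule sum_squared_le_sum_of_squares)
    also have "\<dots> \<le> real M * (potential c k - potential c (Suc k))"
      using potential_decrease[of c k] by (simp add: mult.commute mult_left_mono)
    finally show "norm ((travel k)\<^sup>2) \<le> real M * (potential c k - potential c (Suc k))"
      by simp
  qed
qed

lemma dual_sum_eq:
  "(\<Sum>i=1..M. y k i \<bullet> (x k i - c)) =
    (d - x k M) \<bullet> (x k M - c) - (\<Sum>i=1..M. y k i \<bullet> (x k M - x k i))"
proof -
  have "(d - x k M) \<bullet> (x k M - c) = (\<Sum>i=1..M. y k i \<bullet> (x k M - c))"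
    by (simp add: primal_dual inner_sum_left)
  also have "\<dots> = (\<Sum>i=1..M. y k i \<bullet> (x k i - c)) + (\<Sum>i=1..M. y k i \<bullet> (x k M - x k i))"
    unfolding sum.distrib[symmetric] inner_add_right[symmetric] by simp
  finally show ?thesis by simp
qed

text \<open>
  The small-defect subsequence identifies the limit; the monotone potential then carries the
  convergence over to all cycles, and \<open>distance_to_cycle_end\<close> to all positions within a cycle.
\<close>
lemma tendsto_nearest_point:
  assumes p: "p \<in> (\<Inter>i\<in>J. C i)" and pmin: "\<And>q. q \<in> (\<Inter>i\<in>J. C i) \<Longrightarrow> dist d p \<le> dist d q"
    and i: "i \<le> M"
  shows "(\<lambda>k. x (Suc k) i) \<longlonglongrightarrow> p"
proof -
  note sq = summable_travel_squared[OF p]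
  have travel_0: "travel \<longlonglongrightarrow> 0"
    using tendsto_real_sqrt[OF summable_LIMSEQ_zero[OF sq]] travel_nonneg by simp
  have "\<exists>k\<ge>n. defect k < inverse (Suc n)" for n
    unfolding defect_def using travel_nonneg
    by (intro square_summable_times_partial_sums[OF sq]) (auto intro: sum_nonneg)
  then obtain f where f: "\<And>n. n \<le> f n" "\<And>n. defect (f n) < inverse (Suc n)"
    by metis
  have f_top: "filterlim f at_top sequentially"
    using f(1) by (intro filterlim_at_top_mono[OF filterlim_ident]) (auto intro: always_eventually)
  have defect_0: "(\<lambda>n. defect (f n)) \<longlonglongrightarrow> 0"
    using tendsto_sandwich[of "\<lambda>_. 0" "\<lambda>n. defect (f n)" sequentially "\<lambda>n. inverse (Suc n)" 0]
      f(2) defect_nonneg LIMSEQ_inverse_real_of_nat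
    by (simp add: less_imp_le always_eventually)
  define w where "w n = x (Suc (f n)) M" for n
  have w_p: "w \<longlonglongrightarrow> p"
  proof (rule asymptotically_optimal_tendsto_nearest_point[OF closed_C convex_C p pmin])
    fix i assume iJ: "i \<in> J"
    have "infdist (w n) (C i) \<le> travel (f n)" for n
      using iJ J x_in_C[OF iJ] distance_to_cycle_end[of i "f n"] unfolding w_def
      by (intro infdist_le2[of "x (Suc (f n)) i"]) (auto simp: dist_norm)
    then show "(\<lambda>n. infdist (w n) (C i)) \<longlonglongrightarrow> 0"
      using tendsto_sandwich[of "\<lambda>_. 0" "\<lambda>n. infdist (w n) (C i)" sequentially "\<lambda>n. travel (f n)" 0]
        filterlim_compose[OF travel_0 f_top]
      by (simp add: infdist_nonneg always_eventually)
  next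
    fix n
    have "- defect (f n) \<le> (d - w n) \<bullet> (w n - p)"
      using dual_sum_nonneg[OF p, of "Suc (f n)"] dual_pairing_le_defect[of "f n"]
      unfolding dual_sum_eq w_def by linarith
    \<comment> \<open>An almost nonnegative inner product means an almost obtuse angle at \<open>w n\<close>, so \<open>p\<close> is
      at least almost as far from \<open>d\<close> as \<open>w n\<close> is.\<close>
    moreover have "(dist d p)\<^sup>2 = (dist d (w n))\<^sup>2 + (norm (w n - p))\<^sup>2 + 2 * ((d - w n) \<bullet> (w n - p))"
      by (simp add: dist_norm power2_norm_eq_inner algebra_simps inner_commute)
    ultimately have "(dist d (w n))\<^sup>2 \<le> (dist d p)\<^sup>2 + 2 * defect (f n)"
      using zero_le_power2[of "norm (w n - p)"] by linarith
    then show "dist d (w n) \<le> sqrt ((dist d p)\<^sup>2 + 2 * defect (f n))"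
      by (rule real_le_rsqrt)
  next
    have "(\<lambda>n. sqrt ((dist d p)\<^sup>2 + 2 * defect (f n))) \<longlonglongrightarrow> sqrt ((dist d p)\<^sup>2 + 2 * 0)"
      by (intro tendsto_intros defect_0)
    then show "(\<lambda>n. sqrt ((dist d p)\<^sup>2 + 2 * defect (f n))) \<longlonglongrightarrow> dist d p"
      by simp
  qed
  \<comment> \<open>Once \<open>w\<close> converges to \<open>p\<close>, \<open>dual_sum_eq\<close> makes the dual sum vanish along the subsequence.\<close>
  have pot_le: "potential p (Suc (f n)) \<le>
      (norm (w n - p))\<^sup>2 + 2 * ((d - w n) \<bullet> (w n - p) + defect (f n))" for n
    using dual_pairing_le_defect[of "f n"] unfolding potential_def dual_sum_eq w_def
    by (simp add: abs_le_iff)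
  have "(\<lambda>n. (norm (w n - p))\<^sup>2 + 2 * ((d - w n) \<bullet> (w n - p) + defect (f n)))
      \<longlonglongrightarrow> (norm (p - p))\<^sup>2 + 2 * ((d - p) \<bullet> (p - p) + 0)"
    by (intro tendsto_intros w_p defect_0)
  then have lim0: "(\<lambda>n. (norm (w n - p))\<^sup>2 + 2 * ((d - w n) \<bullet> (w n - p) + defect (f n))) \<longlonglongrightarrow> 0"
    by simp
  have pot_nonneg: "0 \<le> potential p k" for k
    using potential_ge[OF p, of k] by (rule order_trans[rotated]) simp
  have "potential p \<longlonglongrightarrow> 0"
  proof (rule LIMSEQ_I)
    fix e :: real assume "0 < e"
    then obtain n where "(norm (w n - p))\<^sup>2 + 2 * ((d - w n) \<bullet> (w n - p) + defect (f n)) < e"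
      using order_tendstoD(2)[OF lim0] by (auto simp: eventually_sequentially)
    with pot_le[of n] have "potential p (Suc (f n)) < e" by linarith
    then show "\<exists>N. \<forall>k\<ge>N. norm (potential p k - 0) < e"
      using decseqD[OF decseq_potential] pot_nonneg
      by (intro exI[of _ "Suc (f n)"]) (auto intro: le_less_trans)
  qed
  then have "(\<lambda>k. sqrt (potential p (Suc k)) + travel k) \<longlonglongrightarrow> sqrt 0 + 0"
    by (intro tendsto_add tendsto_real_sqrt travel_0) (rule LIMSEQ_Suc)
  moreover have "norm (x (Suc k) i - p) \<le> sqrt (potential p (Suc k)) + travel k" for k
  proof -
    have "norm (x (Suc k) M - p) \<le> sqrt (potential p (Suc k))"
      using potential_ge[OF p] by (rule real_le_rsqrt)
    moreover have "norm (x (Suc k) i - p) \<le> norm (x (Suc k) M - p) + norm (x (Suc k) M - x (Suc k) i)"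
      using norm_triangle_ineq4[of "x (Suc k) M - p" "x (Suc k) M - x (Suc k) i"] by simp
    ultimately show ?thesis
      using distance_to_cycle_end[OF i, of k] by linarith
  qed
  ultimately show ?thesis
    using Lim_null_comparison[of "\<lambda>k. x (Suc k) i - p"
        "\<lambda>k. sqrt (potential p (Suc k)) + travel k" sequentially]
    by (simp add: LIM_zero_iff always_eventually)
qed

end

section \<open>Convergence of the extended algorithm\<close>

lemma linear_iterates_tendsto:
  fixes x :: "nat \<Rightarrow> nat \<Rightarrow> 'a::metric_space"
  assumes "\<And>i. i \<in> {1..m + 1} \<Longrightarrow> (\<lambda>k. x k i) \<longlonglongrightarrow> p"
  shows "linear_iterates m x \<longlonglongrightarrow> p"
proof (rule tendstoI)
  fix e :: real assume "0 < e"
  then have "\<forall>\<^sub>F k in sequentially. \<forall>i\<in>{1..m + 1}. dist (x k i) p < e"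
    using tendstoD[OF assms] by (simp add: eventually_ball_finite)
  then obtain N where N: "\<And>k i. N \<le> k \<Longrightarrow> i \<in> {1..m + 1} \<Longrightarrow> dist (x k i) p < e"
    unfolding eventually_sequentially by blast
  have "dist (linear_iterates m x n) p < e" if n: "N * (m + 1) + 1 \<le> n" for n
  proof -
    have "N \<le> (n - 1) div (m + 1)"
      using n by (simp add: less_eq_div_iff_mult_less_eq)
    moreover have "(n - 1) mod (m + 1) + 1 \<in> {1..m + 1}"
      using mod_less_divisor[of "m + 1" "n - 1"] by simp
    ultimately show ?thesis
      using N n by (simp add: linear_iterates_def)
  qed
  then show "\<forall>\<^sub>F n in sequentially. dist (linear_iterates m x n) p < e"
    unfolding eventually_sequentially by blast
qed

theorem theoremA7:
  fixes d :: "'a::{real_inner,complete_space}"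
    and m :: nat
    and C E H :: "nat \<Rightarrow> 'a set"
    and x y z :: "nat \<Rightarrow> nat \<Rightarrow> 'a"
  assumes "m \<ge> 1"
    and "\<And>i. i \<in> {1..m} \<Longrightarrow> closed (C i)"
    and "\<And>i. i \<in> {1..m} \<Longrightarrow> convex (C i)"
    and "(\<Inter>i\<in>{1..m}. C i) \<noteq> {}"
    and "extended_dykstra m d C E H x y z"
  shows "(\<lambda>n. norm (linear_iterates m x n - proj (\<Inter>i\<in>{1..m}. C i) d)) \<longlonglongrightarrow> 0"
proof -
  let ?C = "\<Inter>i\<in>{1..m}. C i" and ?M = "m + 1"
  \<comment> \<open>One family for the fixed sets and the varying last set treats all positions uniformly.\<close>
  define F where "F k i = (if i = ?M then E k else C i)" for k i
  note run = assms(5)[unfolded extended_dykstra_def]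
  have start: "x 0 ?M = d - (\<Sum>i=1..?M. y 0 i)"
    using run by blast
  have cycle:
    "x (Suc k) 0 = x k ?M \<and>
     (\<forall>i\<in>{1..m}. z (Suc k) i = x (Suc k) (i - 1) + y k i \<and>
        x (Suc k) i = proj (C i) (z (Suc k) i) \<and> y (Suc k) i = z (Suc k) i - x (Suc k) i) \<and>
     closed (E (Suc k)) \<and> convex (E (Suc k)) \<and> ?C \<subseteq> E (Suc k) \<and> E (Suc k) \<subseteq> H k \<and>
     z (Suc k) ?M = x (Suc k) m + y k ?M \<and>
     x (Suc k) ?M = proj (E (Suc k)) (z (Suc k) ?M) \<and>
     y (Suc k) ?M = z (Suc k) ?M - x (Suc k) ?M \<and>
     H (Suc k) = {u. y (Suc k) ?M \<bullet> (u - x (Suc k) ?M) \<le> 0}" for k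
    using run[THEN conjunct2, THEN conjunct2, THEN conjunct2, rule_format, of "Suc k"] by simp
  have next_cycle: "x (Suc k) 0 = x k ?M" for k
    using cycle by blast
  have split: "i \<in> {1..m} \<or> i = ?M" if "i \<in> {1..?M}" for i
    using that by auto
  have F: "closed (F (Suc k) i) \<and> convex (F (Suc k) i) \<and> ?C \<subseteq> F (Suc k) i" if "i \<in> {1..?M}" for k i
    using split[OF that] assms(2,3) cycle[of k] unfolding F_def by auto
  have z: "z (Suc k) i = x (Suc k) (i - 1) + y k i" and x: "x (Suc k) i = proj (F (Suc k) i) (z (Suc k) i)"
    and y: "y (Suc k) i = z (Suc k) i - x (Suc k) i" if "i \<in> {1..?M}" for k i
    using split[OF that] cycle[of k] unfolding F_def by auto
  have update: "x (Suc k) i = x (Suc k) (i - 1) + y k i - y (Suc k) i" if "i \<in> {1..?M}" for k i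
    using z[OF that, of k] y[OF that, of k] by simp
  have x_in: "x (Suc k) i \<in> F (Suc k) i" if "i \<in> {1..?M}" for k i
    using F[OF that, of k] assms(4) unfolding x[OF that] by (intro proj_in) auto
  have normal: "y (Suc k) i \<bullet> (q - x (Suc k) i) \<le> 0" if "i \<in> {1..?M}" "q \<in> F (Suc k) i" for k i q
    unfolding y[OF that(1)]
  proof (rule any_closest_point_dot[OF _ _ x_in[OF that(1)] that(2)])
    show "convex (F (Suc k) i)" "closed (F (Suc k) i)"
      using F[OF that(1)] by auto
    then show "\<forall>q\<in>F (Suc k) i. dist (z (Suc k) i) (x (Suc k) i) \<le> dist (z (Suc k) i) q"
      using that(2) unfolding x[OF that(1)] by (auto intro: proj_le)
  qed
  have next_sep: "y (Suc k) i \<bullet> (x (Suc (Suc k)) i - x (Suc k) i) \<le> 0" if i: "i \<in> {1..?M}" for k i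
  proof (cases "i = ?M")
    case True
    have "E (Suc (Suc k)) \<subseteq> {u. y (Suc k) ?M \<bullet> (u - x (Suc k) ?M) \<le> 0}"
      using cycle[of k] cycle[of "Suc k"] by simp
    then show ?thesis
      using x_in[OF i, of "Suc k"] True by (auto simp: F_def)
  next
    case False
    then show ?thesis
      using normal[OF i] x_in[OF i, of "Suc k"] by (simp add: F_def)
  qed
  \<comment> \<open>The conserved sum is carried across the first cycle, which the locale does not see.\<close>
  have first: "x (Suc 0) ?M = d - (\<Sum>i=1..?M. y (Suc 0) i)"
    using sum_of_cycle_updates[of ?M "x (Suc 0)" "y 0" "y (Suc 0)", OF update] start next_cycle[of 0]
    by (simp add: algebra_simps del: sum.cl_ivl_Suc)
  interpret dykstra_cycles ?M "{1..m}" d C "\<lambda>k. x (Suc k)" "\<lambda>k. y (Suc k)"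
  proof
    fix k i c
    show "{1..m} \<subseteq> {1..?M}" by auto
    show "i \<in> {1..m} \<Longrightarrow> closed (C i)" "i \<in> {1..m} \<Longrightarrow> convex (C i)"
      using assms(2,3) by blast+
    show "i \<in> {1..m} \<Longrightarrow> x (Suc k) i \<in> C i"
      using x_in[of i k] by (simp add: F_def split: if_splits)
    show "i \<in> {1..?M} \<Longrightarrow> c \<in> ?C \<Longrightarrow> y (Suc k) i \<bullet> (c - x (Suc k) i) \<le> 0"
      using normal F by blast
  qed (fact first next_cycle | erule update next_sep)+
  have clC: "closed ?C" and cvC: "convex ?C"
    using assms(2,3) by (auto intro: closed_INT convex_INT)
  have "(\<lambda>k. x k i) \<longlonglongrightarrow> proj ?C d" if "i \<in> {1..?M}" for i
  proof (rule LIMSEQ_imp_Suc, rule LIMSEQ_imp_Suc)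
    show "(\<lambda>k. x (Suc (Suc k)) i) \<longlonglongrightarrow> proj ?C d"
      using that proj_in[OF clC cvC assms(4)] proj_le[OF clC cvC assms(4)]
      by (intro tendsto_nearest_point) auto
  qed
  then have "linear_iterates m x \<longlonglongrightarrow> proj ?C d"
    by (rule linear_iterates_tendsto)
  then show ?thesis
    by (simp add: LIM_zero tendsto_norm_zero)
qed

end
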